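(* (Short Five Lemma) Let $\mathcal{C}$ be a right exact category. Let $A\xrightarrow{i}B\xrightarrow{d}C$ and $A'\xrightarrow{i'}B'\xrightarrow{d'}C'$ be two conflations in $\mathcal{C}$, and let $(f,g,h)$ be a morphism between them, that is, $f:A\to A'$, $g:B\to B'$, $h:C\to C'$ are morphisms in $\mathcal{C}$ with $gi=i'f$ and $hd=d'g$. If $f$ and $h$ are isomorphisms, then so is $g$.
   Context: A right exact category is an additive category endowed with a distinguished class of kernels (morphisms that are kernels of some morphism), called inflations, such that: [R0] the identity morphism $1_0:0\to 0$ is an inflation; [R1] the composition of any two inflations is an inflation; [R2] the pushout of any inflation along an arbitrary morphism exists and is again an inflation. By [R2] (pushout along $A\to 0$), every inflation $i:A\to B$ has a cokernel $d:B\to C$; such a $d$ is called a deflation, and $A\xrightarrow{i}B\xrightarrow{d}C$ (which is a kernel-cokernel pair) is called a conflation. *)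

theory Defs
  imports "HOL-Algebra.Group"
begin

record ('o, 'm) category_data =
  Ob :: "'o set"
  Ar :: "'m set"
  Dom :: "'m \<Rightarrow> 'o"
  Cod :: "'m \<Rightarrow> 'o"
  Id :: "'o \<Rightarrow> 'm"
  Comp :: "'m \<Rightarrow> 'm \<Rightarrow> 'm"  (infixl "\<cdot>\<index>" 70)

definition Hom :: "('o, 'm, 'z) category_data_scheme \<Rightarrow> 'o \<Rightarrow> 'o \<Rightarrow> 'm set" where
  "Hom \<C> A B = {f \<in> Ar \<C>. Dom \<C> f = A \<and> Cod \<C> f = B}"

text \<open>
  The functions \<open>Dom\<close>, \<open>Cod\<close>, \<open>Id\<close> and \<open>Comp\<close> are
  unconstrained outside \<open>Ob\<close>, \<open>Ar\<close> and the composable pairs.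
  Composition is written in the usual order: \<open>g \<cdot> f\<close> is ``first f, then g''.
\<close>

locale category =
  fixes \<C> :: "('o, 'm, 'z) category_data_scheme" (structure)
  assumes Dom_in_Ob: "f \<in> Ar \<C> \<Longrightarrow> Dom \<C> f \<in> Ob \<C>"
    and Cod_in_Ob: "f \<in> Ar \<C> \<Longrightarrow> Cod \<C> f \<in> Ob \<C>"
    and Id_in_Hom: "A \<in> Ob \<C> \<Longrightarrow> Id \<C> A \<in> Hom \<C> A A"
    and Comp_in_Hom: "f \<in> Hom \<C> A B \<Longrightarrow> g \<in> Hom \<C> B D \<Longrightarrow> g \<cdot> f \<in> Hom \<C> A D"
    and Comp_Id_right: "f \<in> Hom \<C> A B \<Longrightarrow> f \<cdot> Id \<C> A = f"
    and Comp_Id_left: "f \<in> Hom \<C> A B \<Longrightarrow> Id \<C> B \<cdot> f = f"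
    and Comp_assoc:
      "f \<in> Hom \<C> A B \<Longrightarrow> g \<in> Hom \<C> B D \<Longrightarrow> h \<in> Hom \<C> D E \<Longrightarrow>
        (h \<cdot> g) \<cdot> f = h \<cdot> (g \<cdot> f)"

definition is_isomorphism :: "('o, 'm, 'z) category_data_scheme \<Rightarrow> 'm \<Rightarrow> bool" where
  "is_isomorphism \<C> f \<longleftrightarrow> f \<in> Ar \<C> \<and>
    (\<exists>g \<in> Hom \<C> (Cod \<C> f) (Dom \<C> f).
      g \<cdot>\<^bsub>\<C>\<^esub> f = Id \<C> (Dom \<C> f) \<and> f \<cdot>\<^bsub>\<C>\<^esub> g = Id \<C> (Cod \<C> f))"

definition is_zero_object :: "('o, 'm, 'z) category_data_scheme \<Rightarrow> 'o \<Rightarrow> bool" where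
  "is_zero_object \<C> Z \<longleftrightarrow> Z \<in> Ob \<C> \<and>
    (\<forall>A \<in> Ob \<C>. (\<exists>!f. f \<in> Hom \<C> A Z) \<and> (\<exists>!f. f \<in> Hom \<C> Z A))"

text \<open>
  \<open>is_pushout \<C> i f i' f'\<close>: the square with the span \<open>i : A \<rightarrow> B\<close>,
  \<open>f : A \<rightarrow> A'\<close> and the cospan \<open>f' : B \<rightarrow> P\<close>, \<open>i' : A' \<rightarrow> P\<close> is a
  pushout; \<open>i'\<close> is the pushout of \<open>i\<close> along \<open>f\<close>.
\<close>

definition is_pushout ::
  "('o, 'm, 'z) category_data_scheme \<Rightarrow> 'm \<Rightarrow> 'm \<Rightarrow> 'm \<Rightarrow> 'm \<Rightarrow> bool" where
  "is_pushout \<C> i f i' f' \<longleftrightarrow>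
    i \<in> Ar \<C> \<and> f \<in> Ar \<C> \<and> i' \<in> Ar \<C> \<and> f' \<in> Ar \<C> \<and>
    Dom \<C> i = Dom \<C> f \<and> Dom \<C> f' = Cod \<C> i \<and> Dom \<C> i' = Cod \<C> f \<and>
    Cod \<C> f' = Cod \<C> i' \<and>
    f' \<cdot>\<^bsub>\<C>\<^esub> i = i' \<cdot>\<^bsub>\<C>\<^esub> f \<and>
    (\<forall>Q \<in> Ob \<C>. \<forall>u \<in> Hom \<C> (Cod \<C> i) Q. \<forall>v \<in> Hom \<C> (Cod \<C> f) Q.
      u \<cdot>\<^bsub>\<C>\<^esub> i = v \<cdot>\<^bsub>\<C>\<^esub> f \<longrightarrow>
      (\<exists>!w. w \<in> Hom \<C> (Cod \<C> i') Q \<and> w \<cdot>\<^bsub>\<C>\<^esub> f' = u \<and> w \<cdot>\<^bsub>\<C>\<^esub> i' = v))"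

record ('o, 'm) additive_data = "('o, 'm) category_data" +
  Add :: "'m \<Rightarrow> 'm \<Rightarrow> 'm"  (infixl "\<boxplus>\<index>" 65)
  Zero :: "'o \<Rightarrow> 'o \<Rightarrow> 'm"

definition hom_group ::
  "('o, 'm, 'z) additive_data_scheme \<Rightarrow> 'o \<Rightarrow> 'o \<Rightarrow> 'm monoid" where
  "hom_group \<C> A B = \<lparr>carrier = Hom \<C> A B, mult = Add \<C>, one = Zero \<C> A B\<rparr>"

definition is_biproduct ::
  "('o, 'm, 'z) additive_data_scheme \<Rightarrow> 'o \<Rightarrow> 'o \<Rightarrow> 'o \<Rightarrow> 'm \<Rightarrow> 'm \<Rightarrow> 'm \<Rightarrow> 'm \<Rightarrow> bool" where
  "is_biproduct \<C> A B S j k p q \<longleftrightarrow>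
    j \<in> Hom \<C> A S \<and> k \<in> Hom \<C> B S \<and> p \<in> Hom \<C> S A \<and> q \<in> Hom \<C> S B \<and>
    p \<cdot>\<^bsub>\<C>\<^esub> j = Id \<C> A \<and> q \<cdot>\<^bsub>\<C>\<^esub> k = Id \<C> B \<and>
    p \<cdot>\<^bsub>\<C>\<^esub> k = Zero \<C> B A \<and> q \<cdot>\<^bsub>\<C>\<^esub> j = Zero \<C> A B \<and>
    (j \<cdot>\<^bsub>\<C>\<^esub> p) \<boxplus>\<^bsub>\<C>\<^esub> (k \<cdot>\<^bsub>\<C>\<^esub> q) = Id \<C> S"

locale additive_category = category \<C>
  for \<C> :: "('o, 'm, 'z) additive_data_scheme" (structure) +
  assumes hom_comm_group:
      "A \<in> Ob \<C> \<Longrightarrow> B \<in> Ob \<C> \<Longrightarrow> comm_group (hom_group \<C> A B)"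
    and Comp_Add_right:
      "f \<in> Hom \<C> A B \<Longrightarrow> f' \<in> Hom \<C> A B \<Longrightarrow> g \<in> Hom \<C> B D \<Longrightarrow>
        g \<cdot> (f \<boxplus> f') = (g \<cdot> f) \<boxplus> (g \<cdot> f')"
    and Comp_Add_left:
      "f \<in> Hom \<C> A B \<Longrightarrow> g \<in> Hom \<C> B D \<Longrightarrow> g' \<in> Hom \<C> B D \<Longrightarrow>
        (g \<boxplus> g') \<cdot> f = (g \<cdot> f) \<boxplus> (g' \<cdot> f)"
    and zero_object_exists: "\<exists>Z. is_zero_object \<C> Z"
    and biproduct_exists:
      "A \<in> Ob \<C> \<Longrightarrow> B \<in> Ob \<C> \<Longrightarrow> \<exists>S j k p q. is_biproduct \<C> A B S j k p q"

definition is_kernel :: "('o, 'm, 'z) additive_data_scheme \<Rightarrow> 'm \<Rightarrow> 'm \<Rightarrow> bool" where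
  "is_kernel \<C> k f \<longleftrightarrow>
    k \<in> Ar \<C> \<and> f \<in> Ar \<C> \<and> Cod \<C> k = Dom \<C> f \<and>
    f \<cdot>\<^bsub>\<C>\<^esub> k = Zero \<C> (Dom \<C> k) (Cod \<C> f) \<and>
    (\<forall>T \<in> Ob \<C>. \<forall>t \<in> Hom \<C> T (Dom \<C> f).
      f \<cdot>\<^bsub>\<C>\<^esub> t = Zero \<C> T (Cod \<C> f) \<longrightarrow>
      (\<exists>!u. u \<in> Hom \<C> T (Dom \<C> k) \<and> k \<cdot>\<^bsub>\<C>\<^esub> u = t))"

definition is_cokernel :: "('o, 'm, 'z) additive_data_scheme \<Rightarrow> 'm \<Rightarrow> 'm \<Rightarrow> bool" where
  "is_cokernel \<C> c f \<longleftrightarrow>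
    c \<in> Ar \<C> \<and> f \<in> Ar \<C> \<and> Dom \<C> c = Cod \<C> f \<and>
    c \<cdot>\<^bsub>\<C>\<^esub> f = Zero \<C> (Dom \<C> f) (Cod \<C> c) \<and>
    (\<forall>T \<in> Ob \<C>. \<forall>t \<in> Hom \<C> (Cod \<C> f) T.
      t \<cdot>\<^bsub>\<C>\<^esub> f = Zero \<C> (Dom \<C> f) T \<longrightarrow>
      (\<exists>!u. u \<in> Hom \<C> (Cod \<C> c) T \<and> u \<cdot>\<^bsub>\<C>\<^esub> c = t))"

text \<open>
  Zero objects and pushouts are determined only up to isomorphism: R0 is imposed for every
  zero object, and R2 says that a pushout exists and that every choice of it yields an inflation.
\<close>

locale right_exact_category = additive_category \<C>
  for \<C> :: "('o, 'm, 'z) additive_data_scheme" (structure) +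
  fixes Infl :: "'m set"
  assumes inflation_is_kernel: "i \<in> Infl \<Longrightarrow> \<exists>f. is_kernel \<C> i f"
    and R0: "is_zero_object \<C> Z \<Longrightarrow> Id \<C> Z \<in> Infl"
    and R1: "i \<in> Infl \<Longrightarrow> j \<in> Infl \<Longrightarrow> Cod \<C> i = Dom \<C> j \<Longrightarrow> j \<cdot> i \<in> Infl"
    and R2_exists:
      "i \<in> Infl \<Longrightarrow> f \<in> Ar \<C> \<Longrightarrow> Dom \<C> f = Dom \<C> i \<Longrightarrow> \<exists>i' f'. is_pushout \<C> i f i' f'"
    and R2_inflation: "i \<in> Infl \<Longrightarrow> is_pushout \<C> i f i' f' \<Longrightarrow> i' \<in> Infl"

definition deflation :: "('o, 'm, 'z) additive_data_scheme \<Rightarrow> 'm set \<Rightarrow> 'm \<Rightarrow> bool" where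
  "deflation \<C> Infl d \<longleftrightarrow> (\<exists>i \<in> Infl. is_cokernel \<C> d i)"

definition conflation ::
  "('o, 'm, 'z) additive_data_scheme \<Rightarrow> 'm set \<Rightarrow> 'o \<Rightarrow> 'm \<Rightarrow> 'o \<Rightarrow> 'm \<Rightarrow> 'o \<Rightarrow> bool" where
  "conflation \<C> Infl A i B d D \<longleftrightarrow>
    i \<in> Hom \<C> A B \<and> d \<in> Hom \<C> B D \<and> i \<in> Infl \<and> is_cokernel \<C> d i"

end

theory Submission
  imports Defs
begin

text \<open>
  Push \<open>i'\<close> out along \<open>i \<cdot> f\<^sup>-\<^sup>1\<close> to get an inflation \<open>k : B \<rightarrow> P\<close> and
  \<open>j : B' \<rightarrow> P\<close>. The morphisms \<open>1\<close> and \<open>g\<close> induce \<open>r : P \<rightarrow> B'\<close> with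
  \<open>r j = 1\<close>, \<open>r k = g\<close>, and \<open>k - j g\<close> vanishes on \<open>i\<close>, so it is \<open>s d\<close> for some
  \<open>s : C \<rightarrow> P\<close>; thus \<open>P\<close> is the biproduct of \<open>B'\<close> and \<open>C\<close>, with \<open>k = (g, d)\<close>.
  Since \<open>d = h\<^sup>-\<^sup>1 d' g\<close>, \<open>k\<close> factors as \<open>t g\<close> with \<open>t = j + s h\<^sup>-\<^sup>1 d'\<close> and
  \<open>r t = 1\<close>. Being a kernel of some \<open>e\<close>, and \<open>e t\<close> being zero, \<open>k\<close> also divides \<open>t\<close>,
  say \<open>t = k u\<close>, and \<open>u\<close> is the inverse of \<open>g\<close>.
\<close>

section \<open>Isomorphisms and pushouts with explicit source and target\<close>

lemma is_isomorphismE: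
  assumes "is_isomorphism \<C> f" "f \<in> Hom \<C> A B"
  obtains g where "g \<in> Hom \<C> B A" "g \<cdot>\<^bsub>\<C>\<^esub> f = Id \<C> A" "f \<cdot>\<^bsub>\<C>\<^esub> g = Id \<C> B"
  using assms unfolding is_isomorphism_def Hom_def by auto

lemma is_isomorphismI:
  assumes "f \<in> Hom \<C> A B" "g \<in> Hom \<C> B A" "g \<cdot>\<^bsub>\<C>\<^esub> f = Id \<C> A" "f \<cdot>\<^bsub>\<C>\<^esub> g = Id \<C> B"
  shows "is_isomorphism \<C> f"
  using assms unfolding is_isomorphism_def Hom_def by auto

context category
begin

lemma Hom_Ob: "f \<in> Hom \<C> A B \<Longrightarrow> A \<in> Ob \<C> \<and> B \<in> Ob \<C>"
  using Dom_in_Ob Cod_in_Ob by (auto simp: Hom_def)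

lemma pushout_Hom:
  assumes "is_pushout \<C> i f i' f'" "i \<in> Hom \<C> A B" "f \<in> Hom \<C> A D"
  obtains P where "i' \<in> Hom \<C> D P" "f' \<in> Hom \<C> B P" "f' \<cdot> i = i' \<cdot> f"
  using assms unfolding is_pushout_def Hom_def by auto

lemma pushout_factor:
  assumes "is_pushout \<C> i f i' f'" "i' \<in> Hom \<C> D P" "f' \<in> Hom \<C> B P"
    and "u \<in> Hom \<C> B Q" "v \<in> Hom \<C> D Q" "u \<cdot> i = v \<cdot> f"
  obtains w where "w \<in> Hom \<C> P Q" "w \<cdot> f' = u" "w \<cdot> i' = v"
proof -
  have "Q \<in> Ob \<C>" "Cod \<C> i = B" "Cod \<C> f = D" "Cod \<C> i' = P"
    using assms Hom_Ob unfolding is_pushout_def Hom_def by auto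
  then show thesis
    using that assms unfolding is_pushout_def by metis
qed

end

section \<open>Group laws on the Hom-sets and composition with zero morphisms\<close>

context additive_category
begin

lemma Add_in_Hom: "f \<in> Hom \<C> A B \<Longrightarrow> g \<in> Hom \<C> A B \<Longrightarrow> f \<boxplus> g \<in> Hom \<C> A B"
  using monoid.m_closed[of "hom_group \<C> A B" f g] hom_comm_group[of A B] Hom_Ob[of f A B]
  by (simp add: hom_group_def comm_group_def group_def)

lemma Zero_in_Hom: "A \<in> Ob \<C> \<Longrightarrow> B \<in> Ob \<C> \<Longrightarrow> Zero \<C> A B \<in> Hom \<C> A B"
  using monoid.one_closed[of "hom_group \<C> A B"] hom_comm_group[of A B]
  by (simp add: hom_group_def comm_group_def group_def)

lemma Add_Zero_left: "f \<in> Hom \<C> A B \<Longrightarrow> Zero \<C> A B \<boxplus> f = f"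
  using monoid.l_one[of "hom_group \<C> A B" f] hom_comm_group[of A B] Hom_Ob[of f A B]
  by (simp add: hom_group_def comm_group_def group_def)

lemma Add_commute:
  "f \<in> Hom \<C> A B \<Longrightarrow> g \<in> Hom \<C> A B \<Longrightarrow> f \<boxplus> g = g \<boxplus> f"
  using comm_monoid.m_comm[of "hom_group \<C> A B" f g] hom_comm_group[of A B] Hom_Ob[of f A B]
  by (simp add: hom_group_def comm_group_def)

lemma Add_assoc:
  "f \<in> Hom \<C> A B \<Longrightarrow> g \<in> Hom \<C> A B \<Longrightarrow> h \<in> Hom \<C> A B \<Longrightarrow>
    (f \<boxplus> g) \<boxplus> h = f \<boxplus> (g \<boxplus> h)"
  using monoid.m_assoc[of "hom_group \<C> A B" f g h] hom_comm_group[of A B] Hom_Ob[of f A B]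
  by (simp add: hom_group_def comm_group_def group_def)

text \<open>Cancellation in the Hom group. With biadditivity of composition it shows that composites
  with zero morphisms are zero.\<close>

lemma Add_idem_imp_Zero:
  "f \<in> Hom \<C> A B \<Longrightarrow> f \<boxplus> f = f \<Longrightarrow> f = Zero \<C> A B"
  using group.l_cancel_one[of "hom_group \<C> A B" f f] hom_comm_group[of A B] Hom_Ob[of f A B]
  by (simp add: hom_group_def comm_group_def)

text \<open>The record carries addition and zero but no negation, so negatives enter as witnesses
  \<open>n\<close>.\<close>

lemma Add_inverse_exists:
  assumes "f \<in> Hom \<C> A B"
  obtains n where "n \<in> Hom \<C> A B" "f \<boxplus> n = Zero \<C> A B"
  using group.r_inv_ex[of "hom_group \<C> A B" f] hom_comm_group[of A B] Hom_Ob[of f A B] assms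
  by (auto simp: hom_group_def comm_group_def)

lemma Comp_Zero_right:
  assumes "g \<in> Hom \<C> B D" "A \<in> Ob \<C>"
  shows "g \<cdot> Zero \<C> A B = Zero \<C> A D"
proof -
  have z: "Zero \<C> A B \<in> Hom \<C> A B"
    using assms Zero_in_Hom Hom_Ob by blast
  have "g \<cdot> Zero \<C> A B \<boxplus> g \<cdot> Zero \<C> A B = g \<cdot> Zero \<C> A B"
    using Comp_Add_right[OF z z assms(1)] Add_Zero_left[OF z] by simp
  then show ?thesis
    using Add_idem_imp_Zero Comp_in_Hom[OF z assms(1)] by blast
qed

lemma Comp_Zero_left:
  assumes "f \<in> Hom \<C> A B" "D \<in> Ob \<C>"
  shows "Zero \<C> B D \<cdot> f = Zero \<C> A D"
proof -
  have z: "Zero \<C> B D \<in> Hom \<C> B D"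
    using assms Zero_in_Hom Hom_Ob by blast
  have "Zero \<C> B D \<cdot> f \<boxplus> Zero \<C> B D \<cdot> f = Zero \<C> B D \<cdot> f"
    using Comp_Add_left[OF assms(1) z z] Add_Zero_left[OF z] by simp
  then show ?thesis
    using Add_idem_imp_Zero Comp_in_Hom[OF assms(1) z] by blast
qed

section \<open>Universal properties of cokernels and kernels\<close>

lemma cokernel_factor:
  assumes "is_cokernel \<C> d i" "i \<in> Hom \<C> A B" "d \<in> Hom \<C> B D"
    and "t \<in> Hom \<C> B T" "t \<cdot> i = Zero \<C> A T"
  obtains u where "u \<in> Hom \<C> D T" "u \<cdot> d = t"
proof -
  have "T \<in> Ob \<C>" "Dom \<C> i = A" "Cod \<C> i = B" "Cod \<C> d = D"
    using assms Hom_Ob unfolding Hom_def by auto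
  then show thesis
    using that assms unfolding is_cokernel_def by metis
qed

text \<open>The morphism \<open>u \<cdot> d\<close> vanishes on \<open>i\<close>, and both
  \<open>u\<close> and \<open>v\<close> factor it through \<open>d\<close>; uniqueness of the
  factorization identifies them.\<close>

lemma cokernel_epi:
  assumes "is_cokernel \<C> d i" "d \<in> Hom \<C> B D"
    and "u \<in> Hom \<C> D T" "v \<in> Hom \<C> D T" "u \<cdot> d = v \<cdot> d"
  shows "u = v"
proof -
  let ?A = "Dom \<C> i"
  have i: "i \<in> Hom \<C> ?A B" and di: "d \<cdot> i = Zero \<C> ?A D"
    and cod: "Cod \<C> i = B" "Cod \<C> d = D"
    using assms(1,2) unfolding is_cokernel_def Hom_def by auto
  have ud: "u \<cdot> d \<in> Hom \<C> B T"
    using assms Comp_in_Hom by blast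
  have "(u \<cdot> d) \<cdot> i = Zero \<C> ?A T"
    using Comp_assoc[OF i assms(2,3)] di Comp_Zero_right[OF assms(3)] Hom_Ob[OF i] by simp
  moreover have "T \<in> Ob \<C>"
    using Hom_Ob ud by blast
  ultimately have "\<exists>!w. w \<in> Hom \<C> D T \<and> w \<cdot> d = u \<cdot> d"
    using assms(1) ud unfolding is_cokernel_def cod by blast
  then show ?thesis
    using assms by auto
qed

lemma kernel_factor:
  assumes "is_kernel \<C> k e" "k \<in> Hom \<C> B P" "e \<in> Hom \<C> P X"
    and "t \<in> Hom \<C> T P" "e \<cdot> t = Zero \<C> T X"
  obtains u where "u \<in> Hom \<C> T B" "k \<cdot> u = t"
proof -
  have "T \<in> Ob \<C>" "Dom \<C> e = P" "Cod \<C> e = X" "Dom \<C> k = B"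
    using assms Hom_Ob unfolding Hom_def by auto
  then show thesis
    using that assms unfolding is_kernel_def by metis
qed

lemma kernel_mono:
  assumes "is_kernel \<C> k e" "k \<in> Hom \<C> B P"
    and "u \<in> Hom \<C> T B" "v \<in> Hom \<C> T B" "k \<cdot> u = k \<cdot> v"
  shows "u = v"
proof -
  let ?X = "Cod \<C> e"
  have e: "e \<in> Hom \<C> P ?X" and ek: "e \<cdot> k = Zero \<C> B ?X"
    and dom: "Dom \<C> e = P" "Dom \<C> k = B"
    using assms(1,2) unfolding is_kernel_def Hom_def by auto
  have ku: "k \<cdot> u \<in> Hom \<C> T P"
    using assms Comp_in_Hom by blast
  have "e \<cdot> (k \<cdot> u) = Zero \<C> T ?X"
    using Comp_assoc[OF assms(3,2) e] ek Comp_Zero_left[OF assms(3)] Hom_Ob[OF e] by simp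
  moreover have "T \<in> Ob \<C>"
    using Hom_Ob ku by blast
  ultimately have "\<exists>!w. w \<in> Hom \<C> T B \<and> k \<cdot> w = k \<cdot> u"
    using assms(1) ku unfolding is_kernel_def dom by blast
  then show ?thesis
    using assms by auto
qed

end

theorem lemma5p3:
  fixes \<C> :: "('o, 'm, 'z) additive_data_scheme"
    and Infl :: "'m set"
    and A B C A' B' C' :: 'o
    and i d i' d' f g h :: 'm
  assumes "right_exact_category \<C> Infl"
    and "conflation \<C> Infl A i B d C"
    and "conflation \<C> Infl A' i' B' d' C'"
    and "f \<in> Hom \<C> A A'" and "g \<in> Hom \<C> B B'" and "h \<in> Hom \<C> C C'"
    and "g \<cdot>\<^bsub>\<C>\<^esub> i = i' \<cdot>\<^bsub>\<C>\<^esub> f"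
    and "h \<cdot>\<^bsub>\<C>\<^esub> d = d' \<cdot>\<^bsub>\<C>\<^esub> g"
    and "is_isomorphism \<C> f" and "is_isomorphism \<C> h"
  shows "is_isomorphism \<C> g"
proof -
  interpret right_exact_category \<C> Infl
    by (fact assms(1))
  have i: "i \<in> Hom \<C> A B" and d: "d \<in> Hom \<C> B C" and cok: "is_cokernel \<C> d i"
    and i': "i' \<in> Hom \<C> A' B'" and d': "d' \<in> Hom \<C> B' C'" and cok': "is_cokernel \<C> d' i'"
    and i'_infl: "i' \<in> Infl"
    using assms(2,3) unfolding conflation_def by auto
  note f = assms(4) and g = assms(5) and h = assms(6) and gi = assms(7) and hd = assms(8)
  have Ob: "A \<in> Ob \<C>" "B \<in> Ob \<C>" "C \<in> Ob \<C>" "A' \<in> Ob \<C>" "B' \<in> Ob \<C>" "C' \<in> Ob \<C>"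
    using Hom_Ob i d i' d' by auto
  obtain f\<^sub>1 where f1: "f\<^sub>1 \<in> Hom \<C> A' A"
    and f1f: "f\<^sub>1 \<cdot>\<^bsub>\<C>\<^esub> f = Id \<C> A" and ff1: "f \<cdot>\<^bsub>\<C>\<^esub> f\<^sub>1 = Id \<C> A'"
    using is_isomorphismE[OF assms(9) f] by blast
  obtain h\<^sub>1 where h1: "h\<^sub>1 \<in> Hom \<C> C' C"
    and h1h: "h\<^sub>1 \<cdot>\<^bsub>\<C>\<^esub> h = Id \<C> C" and hh1: "h \<cdot>\<^bsub>\<C>\<^esub> h\<^sub>1 = Id \<C> C'"
    using is_isomorphismE[OF assms(10) h] by blast
  have if1: "i \<cdot>\<^bsub>\<C>\<^esub> f\<^sub>1 \<in> Hom \<C> A' B"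
    using Comp_in_Hom f1 i by blast

  \<comment> \<open>Inverting \<open>f\<close> gives \<open>i'\<close> and
    \<open>i \<cdot> f\<^sub>1\<close> the common source \<open>A'\<close>, so R2 applies to the
    inflation \<open>i'\<close>.\<close>
  obtain k j where po: "is_pushout \<C> i' (i \<cdot>\<^bsub>\<C>\<^esub> f\<^sub>1) k j"
    using R2_exists[OF i'_infl, of "i \<cdot>\<^bsub>\<C>\<^esub> f\<^sub>1"] if1 i' unfolding Hom_def by auto
  obtain P where k: "k \<in> Hom \<C> B P" and j: "j \<in> Hom \<C> B' P"
    and ji': "j \<cdot>\<^bsub>\<C>\<^esub> i' = k \<cdot>\<^bsub>\<C>\<^esub> (i \<cdot>\<^bsub>\<C>\<^esub> f\<^sub>1)"
    using pushout_Hom[OF po i' if1] by blast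
  have P: "P \<in> Ob \<C>"
    using Hom_Ob k by blast
  \<comment> \<open>Compatibility of the cocone \<open>1\<close>, \<open>g\<close>:
    \<open>g i f\<^sub>1 = i' f f\<^sub>1 = i'\<close>.\<close>
  have "Id \<C> B' \<cdot>\<^bsub>\<C>\<^esub> i' = g \<cdot>\<^bsub>\<C>\<^esub> (i \<cdot>\<^bsub>\<C>\<^esub> f\<^sub>1)"
    using Comp_assoc[OF f1 i g] Comp_assoc[OF f1 f i'] gi ff1 Comp_Id_left[OF i']
      Comp_Id_right[OF i'] by simp
  then obtain r where r: "r \<in> Hom \<C> P B'" and rj: "r \<cdot>\<^bsub>\<C>\<^esub> j = Id \<C> B'" and rk: "r \<cdot>\<^bsub>\<C>\<^esub> k = g"
    using pushout_factor[OF po k j Id_in_Hom[OF Ob(5)] g] by blast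

  have jg: "j \<cdot>\<^bsub>\<C>\<^esub> g \<in> Hom \<C> B P"
    using Comp_in_Hom g j by blast
  \<comment> \<open>Here \<open>n\<close> is the negative of \<open>j g\<close>, so
    \<open>k \<boxplus> n\<close> stands for \<open>k - j g\<close>.\<close>
  obtain n where n: "n \<in> Hom \<C> B P" and jgn: "j \<cdot>\<^bsub>\<C>\<^esub> g \<boxplus>\<^bsub>\<C>\<^esub> n = Zero \<C> B P"
    using Add_inverse_exists[OF jg] by blast
  have "(j \<cdot>\<^bsub>\<C>\<^esub> g) \<cdot>\<^bsub>\<C>\<^esub> i = (j \<cdot>\<^bsub>\<C>\<^esub> i') \<cdot>\<^bsub>\<C>\<^esub> f"
    using Comp_assoc[OF i g j] Comp_assoc[OF f i' j] gi by simp
  also have "\<dots> = k \<cdot>\<^bsub>\<C>\<^esub> ((i \<cdot>\<^bsub>\<C>\<^esub> f\<^sub>1) \<cdot>\<^bsub>\<C>\<^esub> f)"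
    using Comp_assoc[OF f if1 k] ji' by simp
  also have "\<dots> = k \<cdot>\<^bsub>\<C>\<^esub> i"
    using Comp_assoc[OF f f1 i] f1f Comp_Id_right[OF i] by simp
  finally have "(k \<boxplus>\<^bsub>\<C>\<^esub> n) \<cdot>\<^bsub>\<C>\<^esub> i = (j \<cdot>\<^bsub>\<C>\<^esub> g \<boxplus>\<^bsub>\<C>\<^esub> n) \<cdot>\<^bsub>\<C>\<^esub> i"
    using Comp_Add_left[OF i k n] Comp_Add_left[OF i jg n] by simp
  also have "\<dots> = Zero \<C> A P"
    using jgn Comp_Zero_left[OF i P] by simp
  finally obtain s where s: "s \<in> Hom \<C> C P" and sd: "s \<cdot>\<^bsub>\<C>\<^esub> d = k \<boxplus>\<^bsub>\<C>\<^esub> n"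
    using cokernel_factor[OF cok i d Add_in_Hom[OF k n]] by blast
  \<comment> \<open>Both sides equal \<open>g\<close>, so \<open>r\<close> kills
    \<open>k - j g = s d\<close>; since \<open>d\<close> is epi, \<open>r s = 0\<close>.\<close>
  have "r \<cdot>\<^bsub>\<C>\<^esub> (j \<cdot>\<^bsub>\<C>\<^esub> g) = r \<cdot>\<^bsub>\<C>\<^esub> k"
    using Comp_assoc[OF g j r] rj rk Comp_Id_left[OF g] by simp
  then have "r \<cdot>\<^bsub>\<C>\<^esub> (k \<boxplus>\<^bsub>\<C>\<^esub> n) = r \<cdot>\<^bsub>\<C>\<^esub> (j \<cdot>\<^bsub>\<C>\<^esub> g \<boxplus>\<^bsub>\<C>\<^esub> n)"
    using Comp_Add_right[OF k n r] Comp_Add_right[OF jg n r] by simp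
  then have "(r \<cdot>\<^bsub>\<C>\<^esub> s) \<cdot>\<^bsub>\<C>\<^esub> d = Zero \<C> C B' \<cdot>\<^bsub>\<C>\<^esub> d"
    using Comp_assoc[OF d s r] sd jgn Comp_Zero_right[OF r Ob(2)] Comp_Zero_left[OF d Ob(5)] by simp
  then have rs: "r \<cdot>\<^bsub>\<C>\<^esub> s = Zero \<C> C B'"
    using cokernel_epi[OF cok d Comp_in_Hom[OF s r] Zero_in_Hom[OF Ob(3,5)]] by blast

  \<comment> \<open>This \<open>c\<close> extends \<open>d\<close> along \<open>g\<close>, that is
    \<open>c g = d\<close>, and it lifts \<open>d'\<close> through \<open>h\<close>.\<close>
  define c where "c = h\<^sub>1 \<cdot>\<^bsub>\<C>\<^esub> d'"
  have c: "c \<in> Hom \<C> B' C"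
    unfolding c_def using Comp_in_Hom d' h1 by blast
  have cg: "c \<cdot>\<^bsub>\<C>\<^esub> g = d"
    unfolding c_def
    using Comp_assoc[OF g d' h1] Comp_assoc[OF d h h1] hd h1h Comp_Id_left[OF d] by simp
  have hc: "h \<cdot>\<^bsub>\<C>\<^esub> c = d'"
    unfolding c_def using Comp_assoc[OF d' h1 h] hh1 Comp_Id_left[OF d'] by simp
  \<comment> \<open>Under \<open>P = B' \<oplus> C\<close> with injections \<open>j\<close> and
    \<open>s\<close>, this is the morphism with components \<open>1\<close> and \<open>c\<close>.
    Hence \<open>t g = j g + s d = j g + (k - j g) = k\<close>.\<close>
  define t where "t = j \<boxplus>\<^bsub>\<C>\<^esub> s \<cdot>\<^bsub>\<C>\<^esub> c"
  have sc: "s \<cdot>\<^bsub>\<C>\<^esub> c \<in> Hom \<C> B' P"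
    using Comp_in_Hom c s by blast
  have t: "t \<in> Hom \<C> B' P"
    unfolding t_def using Add_in_Hom j sc by blast
  have "t \<cdot>\<^bsub>\<C>\<^esub> g = j \<cdot>\<^bsub>\<C>\<^esub> g \<boxplus>\<^bsub>\<C>\<^esub> (k \<boxplus>\<^bsub>\<C>\<^esub> n)"
    unfolding t_def using Comp_Add_left[OF g j sc] Comp_assoc[OF g c s] cg sd by simp
  also have "\<dots> = (j \<cdot>\<^bsub>\<C>\<^esub> g \<boxplus>\<^bsub>\<C>\<^esub> n) \<boxplus>\<^bsub>\<C>\<^esub> k"
    using Add_commute[OF k n] Add_assoc[OF jg n k] by simp
  also have "\<dots> = k"
    using jgn Add_Zero_left[OF k] by simp
  finally have tg: "t \<cdot>\<^bsub>\<C>\<^esub> g = k" .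
  have "r \<cdot>\<^bsub>\<C>\<^esub> t = Id \<C> B' \<boxplus>\<^bsub>\<C>\<^esub> Zero \<C> B' B'"
    unfolding t_def
    using Comp_Add_right[OF j sc r] Comp_assoc[OF c s r] rj rs Comp_Zero_left[OF c Ob(5)] by simp
  also have "\<dots> = Id \<C> B'"
    using Add_commute Add_Zero_left Id_in_Hom[OF Ob(5)] Zero_in_Hom[OF Ob(5,5)] by metis
  finally have rt: "r \<cdot>\<^bsub>\<C>\<^esub> t = Id \<C> B'" .

  \<comment> \<open>As a pushout of the inflation \<open>i'\<close>, \<open>k\<close> is an
    inflation and so a kernel.\<close>
  obtain e where ker: "is_kernel \<C> k e"
    using inflation_is_kernel R2_inflation i'_infl po by blast
  define X where "X = Cod \<C> e"
  have e: "e \<in> Hom \<C> P X" and ek: "e \<cdot>\<^bsub>\<C>\<^esub> k = Zero \<C> B X"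
    using ker k unfolding is_kernel_def Hom_def X_def by auto
  have X: "X \<in> Ob \<C>"
    using Hom_Ob e by blast
  \<comment> \<open>Towards \<open>e t = 0\<close>. From \<open>t g = k\<close> one gets only
    \<open>e t g = 0\<close>, and \<open>g\<close> is not yet known to be epi. Instead
    \<open>e j\<close> vanishes on \<open>i'\<close>, because \<open>j i' = k i f\<^sub>1\<close>
    and \<open>e k = 0\<close>; so it factors through \<open>d'\<close>.\<close>
  have "(e \<cdot>\<^bsub>\<C>\<^esub> j) \<cdot>\<^bsub>\<C>\<^esub> i' = Zero \<C> A' X"
    using Comp_assoc[OF i' j e] Comp_assoc[OF if1 k e] ji' ek Comp_Zero_left[OF if1 X] by simp
  then obtain w where w: "w \<in> Hom \<C> C' X" and wd': "w \<cdot>\<^bsub>\<C>\<^esub> d' = e \<cdot>\<^bsub>\<C>\<^esub> j"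
    using cokernel_factor[OF cok' i' d' Comp_in_Hom[OF j e]] by blast
  have wh: "w \<cdot>\<^bsub>\<C>\<^esub> h \<in> Hom \<C> C X" and es: "e \<cdot>\<^bsub>\<C>\<^esub> s \<in> Hom \<C> C X"
    using Comp_in_Hom h w s e by blast+
  have en: "e \<cdot>\<^bsub>\<C>\<^esub> n \<in> Hom \<C> B X"
    using Comp_in_Hom n e by blast
  \<comment> \<open>After composition with \<open>d\<close>, \<open>w h\<close> becomes
    \<open>e j g\<close> and \<open>e s\<close> becomes \<open>e n = - e j g\<close>. Their sum
    vanishes, and \<open>d\<close> is epi.\<close>
  have "(w \<cdot>\<^bsub>\<C>\<^esub> h) \<cdot>\<^bsub>\<C>\<^esub> d = e \<cdot>\<^bsub>\<C>\<^esub> (j \<cdot>\<^bsub>\<C>\<^esub> g)"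
    using Comp_assoc[OF d h w] Comp_assoc[OF g d' w] Comp_assoc[OF g j e] hd wd' by simp
  moreover have "(e \<cdot>\<^bsub>\<C>\<^esub> s) \<cdot>\<^bsub>\<C>\<^esub> d = e \<cdot>\<^bsub>\<C>\<^esub> n"
    using Comp_assoc[OF d s e] sd Comp_Add_right[OF k n e] ek Add_Zero_left[OF en] by simp
  ultimately have "(w \<cdot>\<^bsub>\<C>\<^esub> h \<boxplus>\<^bsub>\<C>\<^esub> e \<cdot>\<^bsub>\<C>\<^esub> s) \<cdot>\<^bsub>\<C>\<^esub> d = Zero \<C> C X \<cdot>\<^bsub>\<C>\<^esub> d"
    using Comp_Add_left[OF d wh es] Comp_Add_right[OF jg n e] jgn
      Comp_Zero_right[OF e Ob(2)] Comp_Zero_left[OF d X] by simp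
  then have whes: "w \<cdot>\<^bsub>\<C>\<^esub> h \<boxplus>\<^bsub>\<C>\<^esub> e \<cdot>\<^bsub>\<C>\<^esub> s = Zero \<C> C X"
    using cokernel_epi[OF cok d Add_in_Hom[OF wh es] Zero_in_Hom[OF Ob(3) X]] by blast
  \<comment> \<open>Writing \<open>d' = h c\<close> puts \<open>c\<close> on the right of both
    summands of \<open>e t\<close>, leaving the zero morphism \<open>w h + e s\<close> in
    front.\<close>
  have "e \<cdot>\<^bsub>\<C>\<^esub> j = (w \<cdot>\<^bsub>\<C>\<^esub> h) \<cdot>\<^bsub>\<C>\<^esub> c"
    using Comp_assoc[OF c h w] hc wd' by simp
  then have "e \<cdot>\<^bsub>\<C>\<^esub> t = (w \<cdot>\<^bsub>\<C>\<^esub> h \<boxplus>\<^bsub>\<C>\<^esub> e \<cdot>\<^bsub>\<C>\<^esub> s) \<cdot>\<^bsub>\<C>\<^esub> c"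
    unfolding t_def
    using Comp_Add_right[OF j sc e] Comp_assoc[OF c s e] Comp_Add_left[OF c wh es] by simp
  then have "e \<cdot>\<^bsub>\<C>\<^esub> t = Zero \<C> B' X"
    using whes Comp_Zero_left[OF c X] by simp
  then obtain u where u: "u \<in> Hom \<C> B' B" and ku: "k \<cdot>\<^bsub>\<C>\<^esub> u = t"
    using kernel_factor[OF ker k e t] by blast
  \<comment> \<open>\<open>g u = r k u = r t = 1\<close>.\<close>
  have gu: "g \<cdot>\<^bsub>\<C>\<^esub> u = Id \<C> B'"
    using Comp_assoc[OF u k r] rk ku rt by simp
  \<comment> \<open>\<open>k u g = t g = k\<close>, and the kernel \<open>k\<close> is mono.\<close>
  have "k \<cdot>\<^bsub>\<C>\<^esub> (u \<cdot>\<^bsub>\<C>\<^esub> g) = k \<cdot>\<^bsub>\<C>\<^esub> Id \<C> B"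
    using Comp_assoc[OF g u k] ku tg Comp_Id_right[OF k] by simp
  then have "u \<cdot>\<^bsub>\<C>\<^esub> g = Id \<C> B"
    using kernel_mono[OF ker k Comp_in_Hom[OF g u] Id_in_Hom[OF Ob(2)]] by blast
  then show ?thesis
    using is_isomorphismI[OF g u] gu by blast
qed

end
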